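(* Let $T:c_{0}\times c_{0}\to\mathbb{C}$ be given by $T(z,w)=\sum_{i,j=1}^{2}a_{ij}z_{i}w_{j}$ with $a_{ij}\in\mathbb{R}$. Then $$\left(\sum_{i,j=1}^{2}|T(e_{i},e_{j})|^{\frac{4}{3}}\right)^{\frac{3}{4}}\leq\|T\|$$ whenever one of the following holds: (1) $a_{11}a_{21}=0$ or $a_{12}a_{22}=0$; (2) $a_{11}a_{21}>0$ and $a_{12}a_{22}>0$; (3) $a_{11}a_{21}<0$ and $a_{12}a_{22}<0$; (4) $a_{11}a_{21}>0$ and $a_{12}a_{22}<0$ and $a_{11}a_{21}+a_{12}a_{22}=0$; (5) $a_{11}a_{21}<0$ and $a_{12}a_{22}>0$ and $a_{11}a_{21}+a_{12}a_{22}=0$.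
   Context: Here $c_0$ is the complex Banach space of complex sequences $z=(z_n)_{n\ge1}$ converging to $0$ with the sup norm, $e_i$ are the canonical unit vectors, and $\|T\|=\sup\{|T(z,w)|:\|z\|_\infty\le 1,\|w\|_\infty\le 1\}$. *)

theory Defs
  imports "HOL-Analysis.Analysis"
begin

text \<open>
  Sequences are indexed from \<open>0\<close>: the coordinate \<open>z\<^sub>n\<close> of the mathematical text (\<open>n \<ge> 1\<close>) is \<open>z (n - 1)\<close>.
  As \<open>nat\<close> carries the discrete topology, \<open>nat \<Rightarrow>\<^sub>C complex\<close> is the space of all bounded complex
  sequences with the supremum norm; \<open>c0\<close> is a closed subspace of it.
\<close>

definition c0 :: "(nat \<Rightarrow>\<^sub>C complex) set"
  where "c0 = {z. apply_bcontfun z \<longlonglongrightarrow> 0}"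

definition c0_unit :: "nat \<Rightarrow> (nat \<Rightarrow>\<^sub>C complex)"
  where "c0_unit i = Bcontfun (\<lambda>n. if n = i then 1 else 0)"

lemma c0_unit_apply: "apply_bcontfun (c0_unit i) n = (if n = i then 1 else 0)"
proof -
  have "(\<lambda>n. if n = i then 1 else 0 :: complex) \<in> bcontfun"
    by (rule bcontfun_normI[where b = 1]) (auto intro: continuous_on_discrete)
  then show ?thesis
    by (simp add: c0_unit_def Bcontfun_inverse)
qed

text \<open>
  The supremum is taken in the reals, hence is meaningful only for bounded \<open>T\<close>; the lemma
  \<open>bdd_above_matrix_form\<close> below provides this for the forms of interest.
  Only the values of \<open>T\<close> on \<open>c0 \<times> c0\<close> matter.
\<close>

definition c0_form_norm :: "((nat \<Rightarrow>\<^sub>C complex) \<Rightarrow> (nat \<Rightarrow>\<^sub>C complex) \<Rightarrow> complex) \<Rightarrow> real"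
  where "c0_form_norm T = Sup {cmod (T z w) | z w. z \<in> c0 \<and> w \<in> c0 \<and> norm z \<le> 1 \<and> norm w \<le> 1}"

lemma norm_eq_SUP_cmod: "norm z = (SUP n. cmod (apply_bcontfun z n))"
  for z :: "nat \<Rightarrow>\<^sub>C complex"
  by (simp add: norm_bcontfun_def dist_bcontfun_def)

lemma c0_unit_in_c0: "c0_unit i \<in> c0"
proof -
  have "\<forall>\<^sub>F n in sequentially. apply_bcontfun (c0_unit i) n = 0"
    using eventually_gt_at_top[of i] by eventually_elim (simp add: c0_unit_apply)
  then show ?thesis
    unfolding c0_def by (simp add: tendsto_eventually)
qed

lemma closed_c0: "closed c0"
proof (unfold closed_sequential_limits, intro allI impI, elim conjE)
  fix x l
  assume x: "\<forall>n. x n \<in> c0" and l: "x \<longlonglongrightarrow> l"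
  have "(apply_bcontfun l \<longlongrightarrow> 0) sequentially"
  proof (rule tendstoI)
    fix e :: real assume "e > 0"
    then obtain n where n: "dist (x n) l < e / 2"
      using l by (metis half_gt_zero lim_sequentially order_refl)
    have "\<forall>\<^sub>F k in sequentially. dist (apply_bcontfun (x n) k) 0 < e / 2"
      using x \<open>e > 0\<close> unfolding c0_def by (intro tendstoD) auto
    then show "\<forall>\<^sub>F k in sequentially. dist (apply_bcontfun l k) 0 < e"
    proof eventually_elim
      case (elim k)
      have "dist (apply_bcontfun l k) 0
          \<le> dist (apply_bcontfun (x n) k) (apply_bcontfun l k) + dist (apply_bcontfun (x n) k) 0"
        by (rule dist_triangle3)
      with elim n dist_bounded[of "x n" k l] show ?case by linarith
    qed
  qed
  then show "l \<in> c0" by (simp add: c0_def)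
qed

lemma bdd_above_matrix_form:
  fixes a :: "nat \<Rightarrow> nat \<Rightarrow> real"
  assumes "\<And>z w. z \<in> c0 \<Longrightarrow> w \<in> c0 \<Longrightarrow>
    T z w = (\<Sum>i<2. \<Sum>j<2. complex_of_real (a i j) * apply_bcontfun z i * apply_bcontfun w j)"
  shows "bdd_above {cmod (T z w) | z w. z \<in> c0 \<and> w \<in> c0 \<and> norm z \<le> 1 \<and> norm w \<le> 1}"
proof (rule bdd_aboveI[where M = "\<Sum>i<2. \<Sum>j<2. \<bar>a i j\<bar>"], clarify)
  fix z w :: "nat \<Rightarrow>\<^sub>C complex"
  assume c: "z \<in> c0" "w \<in> c0" and n: "norm z \<le> 1" "norm w \<le> 1"
  have z: "cmod (apply_bcontfun z i) \<le> 1" and w: "cmod (apply_bcontfun w i) \<le> 1" for i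
    using norm_bounded[of z i] norm_bounded[of w i] n by linarith+
  have "cmod (complex_of_real (a i j) * apply_bcontfun z i * apply_bcontfun w j) \<le> \<bar>a i j\<bar>" for i j
    using mult_mono[OF mult_left_mono[OF z[of i], of "\<bar>a i j\<bar>"] w[of j]]
    by (simp add: norm_mult)
  then show "cmod (T z w) \<le> (\<Sum>i<2. \<Sum>j<2. \<bar>a i j\<bar>)"
    unfolding assms[OF c] by (intro sum_norm_le)
qed

end

theory Submission
  imports Defs
begin

text \<open>
  Write \<open>x = (p, q, r, s)\<close> for the coefficients \<open>(a\<^sub>1\<^sub>1, a\<^sub>2\<^sub>1, a\<^sub>1\<^sub>2, a\<^sub>2\<^sub>2)\<close>. By Hoelder interpolation, the square of
  the \<open>\<ell>\<^sub>4\<^sub>/\<^sub>3\<close>-norm of \<open>x\<close> is at most the product of its \<open>\<ell>\<^sub>1\<close>- and \<open>\<ell>\<^sub>2\<close>-norms. Testing the form on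
  \<open>z = (1, u)\<close> with \<open>\<bar>u\<bar> = 1\<close>, \<open>Re u = t\<close>, and on the \<open>w\<close> that aligns the phases bounds its norm
  from below by \<open>sqrt (p\<^sup>2 + q\<^sup>2 + 2pqt) + sqrt (r\<^sup>2 + s\<^sup>2 + 2rst)\<close>. It remains to choose \<open>t\<close>. If
  \<open>pq\<close> and \<open>rs\<close> do not have opposite signs, some \<open>t = \<plusminus>1\<close> gives the \<open>\<ell>\<^sub>1\<close>-norm. If \<open>pq = - rs\<close>, the
  \<open>t\<close> that makes the two summands equal gives \<open>sqrt 2\<close> times the \<open>\<ell>\<^sub>2\<close>-norm, which is enough by
  Cauchy-Schwarz; when that \<open>t\<close> falls outside \<open>[-1, 1]\<close>, the nearest endpoint suffices.
\<close>

section \<open>Interpolation between the l1 and l2 norms\<close>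

text \<open>Since 4/3 = 2/3 * 1 + 1/3 * 2, each \<open>f i powr (4/3)\<close> is, up to the factor
  \<open>(S * L) powr (2/3)\<close>, a weighted geometric mean of \<open>f i / S\<close> and
  \<open>(f i / L) powr 2\<close>. Young's inequality replaces it by the arithmetic mean with
  weights 2/3 and 1/3.\<close>

lemma sum_powr_four_thirds_le:
  fixes f :: "'a \<Rightarrow> real"
  assumes "finite I" and nonneg: "\<And>i. i \<in> I \<Longrightarrow> 0 \<le> f i"
  shows "(\<Sum>i\<in>I. f i powr (4/3)) powr (3/4) \<le> sqrt (sum f I * L2_set f I)"
proof (cases "\<forall>i\<in>I. f i = 0")
  case True
  then show ?thesis by (simp add: L2_set_def)
next
  case False
  define S L where "S = sum f I" and "L = L2_set f I"
  have "S \<noteq> 0"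
    using False assms by (auto simp: S_def sum_nonneg_eq_0_iff)
  then have S: "S > 0"
    using sum_nonneg[of I f] nonneg by (simp add: S_def less_le)
  have "L \<noteq> 0"
    using False assms by (auto simp: L_def L2_set_eq_0_iff)
  then have L: "L > 0"
    using L2_set_nonneg[of f I] by (simp add: L_def less_le)
  have L2: "(\<Sum>i\<in>I. (f i)\<^sup>2) = L\<^sup>2"
    by (simp add: L_def L2_set_def sum_nonneg)
  have pointwise: "f i powr (4/3) \<le> (S * L) powr (2/3) * (2/3 * (f i / S) + 1/3 * ((f i)\<^sup>2 / L\<^sup>2))"
    if "i \<in> I" for i
  proof (cases "f i = 0")
    case False
    then have f: "f i > 0"
      using nonneg[OF that] by simp
    have "((f i / L) powr 2) powr (1/3) = (f i / L) powr (2/3)"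
      by (simp only: powr_powr) simp
    then have "(f i / S) powr (2/3) * ((f i / L) powr 2) powr (1/3)
        = f i powr (2/3) * f i powr (2/3) / (S * L) powr (2/3)"
      using f S L by (simp only: powr_divide powr_mult) simp
    then have "(f i / S) powr (2/3) * ((f i / L) powr 2) powr (1/3) = f i powr (4/3) / (S * L) powr (2/3)"
      by (simp flip: powr_add)
    moreover have "(f i / S) powr (2/3) * ((f i / L) powr 2) powr (1/3)
        \<le> 2/3 * (f i / S) + 1/3 * (f i / L) powr 2"
      using f S L by (intro Youngs_inequality_0) auto
    ultimately have "f i powr (4/3) / (S * L) powr (2/3) \<le> 2/3 * (f i / S) + 1/3 * (f i / L) powr 2"
      by simp
    moreover have "(f i / L) powr 2 = (f i)\<^sup>2 / L\<^sup>2"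
      using f L by (simp add: power_divide)
    moreover have "0 < (S * L) powr (2/3)"
      using S L by simp
    ultimately show ?thesis
      by (metis pos_divide_le_eq mult.commute)
  qed simp
  have "(\<Sum>i\<in>I. f i powr (4/3))
      \<le> (\<Sum>i\<in>I. (S * L) powr (2/3) * (2/3 * (f i / S) + 1/3 * ((f i)\<^sup>2 / L\<^sup>2)))"
    by (intro sum_mono pointwise)
  \<comment> \<open>Both normalised families sum to 1, so the weights add up to 1.\<close>
  also have "\<dots> = (S * L) powr (2/3) * (2/3 * (S / S) + 1/3 * (L\<^sup>2 / L\<^sup>2))"
    by (simp only: sum.distrib L2 S_def flip: sum_distrib_left sum_divide_distrib)
  also have "\<dots> = (S * L) powr (2/3)"
    using S L by simp
  finally have "(\<Sum>i\<in>I. f i powr (4/3)) powr (3/4) \<le> ((S * L) powr (2/3)) powr (3/4)"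
    by (intro powr_mono2 sum_nonneg) auto
  also have "\<dots> = sqrt (S * L)"
    using S L by (simp add: powr_powr powr_half_sqrt)
  finally show ?thesis
    by (simp add: S_def L_def)
qed

section \<open>Lower bounds for the norm of the form\<close>

text \<open>The form sees only two coordinates, so test vectors are obtained by padding with
  zeros.\<close>

lemma c0_vector_exists:
  assumes "cmod x \<le> 1" "cmod y \<le> 1"
  obtains z where "z \<in> c0" "norm z \<le> 1" "apply_bcontfun z 0 = x" "apply_bcontfun z 1 = y"
proof -
  define g where "g n = (if n = 0 then x else if n = 1 then y else 0)" for n :: nat
  have "g \<in> bcontfun"
    using assms by (intro bcontfun_normI[where b = 1]) (auto simp: g_def intro: continuous_on_discrete)
  then have app: "apply_bcontfun (Bcontfun g) = g"
    by (simp add: Bcontfun_inverse)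
  have "\<forall>\<^sub>F n in sequentially. g n = 0"
    using eventually_gt_at_top[of 1] by eventually_elim (simp add: g_def)
  then have "Bcontfun g \<in> c0"
    unfolding c0_def by (simp add: app tendsto_eventually)
  moreover have "norm (Bcontfun g) \<le> 1"
    unfolding norm_eq_SUP_cmod app using assms by (intro cSUP_least) (auto simp: g_def)
  ultimately show thesis
    using that[of "Bcontfun g"] by (simp add: app g_def)
qed

lemma cmod_add_mult_unit:
  fixes p q :: real and u :: complex
  assumes "cmod u = 1"
  shows "cmod (p + q * u) = sqrt (p\<^sup>2 + q\<^sup>2 + 2 * p * q * Re u)"
proof -
  have "(Re u)\<^sup>2 + (Im u)\<^sup>2 = 1"
    using assms by (simp add: cmod_def)
  then have "(p + q * Re u)\<^sup>2 + (q * Im u)\<^sup>2 = p\<^sup>2 + q\<^sup>2 + 2 * p * q * Re u"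
    by algebra
  then show ?thesis by (simp add: cmod_def)
qed

lemma c0_form_norm_ge:
  fixes a :: "nat \<Rightarrow> nat \<Rightarrow> real"
  assumes T: "\<And>z w. z \<in> c0 \<Longrightarrow> w \<in> c0 \<Longrightarrow>
      T z w = (\<Sum>i<2. \<Sum>j<2. complex_of_real (a i j) * apply_bcontfun z i * apply_bcontfun w j)"
    and t: "\<bar>t\<bar> \<le> 1"
  shows "sqrt ((a 0 0)\<^sup>2 + (a 1 0)\<^sup>2 + 2 * a 0 0 * a 1 0 * t)
       + sqrt ((a 0 1)\<^sup>2 + (a 1 1)\<^sup>2 + 2 * a 0 1 * a 1 1 * t) \<le> c0_form_norm T"
proof -
  define u where "u = Complex t (sqrt (1 - t\<^sup>2))"
  have "t\<^sup>2 \<le> 1"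
    using t by (simp add: abs_square_le_1)
  then have u: "cmod u = 1" "Re u = t"
    by (simp_all add: u_def cmod_def)
  define \<alpha> \<beta> where "\<alpha> = a 0 0 + a 1 0 * u" and "\<beta> = a 0 1 + a 1 1 * u"
  obtain z where z: "z \<in> c0" "norm z \<le> 1" "apply_bcontfun z 0 = 1" "apply_bcontfun z 1 = u"
    using c0_vector_exists[of 1 u] u by auto
  \<comment> \<open>For fixed \<open>z\<close> the form is linear in \<open>w\<close> with
    coefficients \<open>\<alpha>\<close> and \<open>\<beta>\<close>. As \<open>sgn 0 = 0\<close>, a
    vanishing coefficient gives a zero coordinate, still in the unit disc.\<close>
  obtain w where w: "w \<in> c0" "norm w \<le> 1"
      "apply_bcontfun w 0 = cnj (sgn \<alpha>)" "apply_bcontfun w 1 = cnj (sgn \<beta>)"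
    by (rule c0_vector_exists[of "cnj (sgn \<alpha>)" "cnj (sgn \<beta>)"]) (auto simp: norm_sgn)
  have sgn: "v * cnj (sgn v) = cmod v" for v
    by (cases "v = 0") (simp_all add: sgn_eq complex_norm_square[symmetric] power2_eq_square)
  have "T z w = \<alpha> * cnj (sgn \<alpha>) + \<beta> * cnj (sgn \<beta>)"
    using z(3,4) w(3,4) unfolding T[OF z(1) w(1)]
    by (simp add: \<alpha>_def \<beta>_def numeral_2_eq_2 algebra_simps)
  also have "\<dots> = of_real (cmod \<alpha> + cmod \<beta>)"
    by (simp add: sgn)
  finally have "cmod (T z w) = cmod \<alpha> + cmod \<beta>"
    by (simp only: norm_of_real) simp
  moreover have "cmod (T z w) \<le> c0_form_norm T"
    unfolding c0_form_norm_def using z w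
    by (intro cSup_upper bdd_above_matrix_form[OF T]) auto
  ultimately show ?thesis
    using cmod_add_mult_unit[OF u(1)] by (simp add: \<alpha>_def \<beta>_def u)
qed

section \<open>Choice of the cosine \<open>t\<close>\<close>

text \<open>At the endpoint where \<open>p * q * t = \<bar>p * q\<bar>\<close> the two roots become
  \<open>m\<close> and \<open>n\<close>. With \<open>R\<close> the l2 norm, both |r| + |s| \<le> R
  and R \<le> 2 n hold, so the left side is at most m R + R^2 \<le> 2 m n + m^2 + n^2 = (m +
  n)^2.\<close>

lemma exists_cosine_unbalanced:
  fixes p q r s :: real
  assumes pq: "p * q = - (r * s)" and gap: "p\<^sup>2 + q\<^sup>2 + 4 * \<bar>p * q\<bar> \<le> r\<^sup>2 + s\<^sup>2"
  shows "\<exists>t. \<bar>t\<bar> \<le> 1 \<and> (\<bar>p\<bar> + \<bar>q\<bar> + \<bar>r\<bar> + \<bar>s\<bar>) * sqrt (p\<^sup>2 + q\<^sup>2 + r\<^sup>2 + s\<^sup>2)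
     \<le> (sqrt (p\<^sup>2 + q\<^sup>2 + 2 * p * q * t) + sqrt (r\<^sup>2 + s\<^sup>2 + 2 * r * s * t))\<^sup>2"
proof -
  define t :: real where "t = (if p * q \<ge> 0 then 1 else - 1)"
  define P where "P = \<bar>p * q\<bar>"
  define m n where "m = \<bar>p\<bar> + \<bar>q\<bar>" and "n = \<bar>\<bar>r\<bar> - \<bar>s\<bar>\<bar>"
  have rs: "\<bar>r\<bar> * \<bar>s\<bar> = P"
    using pq by (simp add: P_def flip: abs_mult)
  have m2: "m\<^sup>2 = p\<^sup>2 + q\<^sup>2 + 2 * P"
    by (simp add: m_def P_def power2_sum abs_mult)
  have n2: "n\<^sup>2 = r\<^sup>2 + s\<^sup>2 - 2 * P"
    using rs by (simp add: n_def power2_diff)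
  have l1: "(\<bar>r\<bar> + \<bar>s\<bar>)\<^sup>2 = n\<^sup>2 + 4 * P"
    using rs by (simp add: n2 power2_sum)
  have "4 * P \<le> m\<^sup>2"
    using sum_squares_bound[of "\<bar>p\<bar>" "\<bar>q\<bar>"] by (simp add: m2 P_def abs_mult)
  have nonneg: "0 \<le> m" "0 \<le> n"
    by (simp_all add: m_def n_def)
  \<comment> \<open>In terms of \<open>m\<close> and \<open>n\<close>, the assumption
    \<open>gap\<close> reads m^2 \<le> n^2.\<close>
  have mn: "m \<le> n"
    using gap nonneg by - (rule power2_le_imp_le, simp_all add: m2 n2 P_def)
  define R where "R = sqrt (m\<^sup>2 + n\<^sup>2)"
  have R: "0 \<le> R" "R\<^sup>2 = m\<^sup>2 + n\<^sup>2"
    by (simp_all add: R_def)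
  have "\<bar>r\<bar> + \<bar>s\<bar> \<le> R"
    using l1 \<open>4 * P \<le> m\<^sup>2\<close> R by - (rule power2_le_imp_le, auto)
  then have "(m + (\<bar>r\<bar> + \<bar>s\<bar>)) * R \<le> (m + R) * R"
    using R by (intro mult_right_mono) auto
  also have "\<dots> = m * R + (m\<^sup>2 + n\<^sup>2)"
    using R(2) by (simp add: power2_eq_square algebra_simps)
  also have "\<dots> \<le> m * (2 * n) + (m\<^sup>2 + n\<^sup>2)"
  proof -
    have "m\<^sup>2 \<le> n\<^sup>2"
      using mn nonneg by (simp add: power_mono)
    then have "R\<^sup>2 \<le> 4 * n\<^sup>2"
      using zero_le_power2[of n] unfolding R(2) by linarith
    then have "R \<le> 2 * n"
      using nonneg by - (rule power2_le_imp_le, simp_all add: power_mult_distrib)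
    then show ?thesis
      using nonneg by (intro add_right_mono mult_left_mono) auto
  qed
  also have "\<dots> = (m + n)\<^sup>2"
    by (simp add: power2_sum)
  finally have main: "(m + (\<bar>r\<bar> + \<bar>s\<bar>)) * R \<le> (m + n)\<^sup>2" .
  have "p * q * t = P" "r * s * t = - P"
    using pq by (auto simp: t_def P_def)
  then have "sqrt (p\<^sup>2 + q\<^sup>2 + 2 * p * q * t) = m" "sqrt (r\<^sup>2 + s\<^sup>2 + 2 * r * s * t) = n"
    using nonneg m2 n2 by (auto intro!: real_sqrt_unique simp: mult.assoc)
  moreover have "R = sqrt (p\<^sup>2 + q\<^sup>2 + r\<^sup>2 + s\<^sup>2)"
    by (simp add: R_def m2 n2 algebra_simps)
  moreover have "\<bar>t\<bar> \<le> 1"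
    by (simp add: t_def)
  ultimately show ?thesis
    using main by (intro exI[of _ t]) (simp add: m_def add.assoc)
qed

lemma exists_cosine_opposite:
  fixes p q r s :: real
  assumes pq: "p * q = - (r * s)" "p * q \<noteq> 0"
  shows "\<exists>t. \<bar>t\<bar> \<le> 1 \<and> (\<bar>p\<bar> + \<bar>q\<bar> + \<bar>r\<bar> + \<bar>s\<bar>) * sqrt (p\<^sup>2 + q\<^sup>2 + r\<^sup>2 + s\<^sup>2)
     \<le> (sqrt (p\<^sup>2 + q\<^sup>2 + 2 * p * q * t) + sqrt (r\<^sup>2 + s\<^sup>2 + 2 * r * s * t))\<^sup>2"
proof -
  define A C where "A = p\<^sup>2 + q\<^sup>2" and "C = r\<^sup>2 + s\<^sup>2"
  \<comment> \<open>The third alternative places the balancing value (C - A) / (4 p q) in [-1, 1];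
    the other two are exchanged by swapping the pairs (p, q) and (r, s).\<close>
  consider "A + 4 * \<bar>p * q\<bar> \<le> C" | "C + 4 * \<bar>r * s\<bar> \<le> A" | "\<bar>C - A\<bar> \<le> 4 * \<bar>p * q\<bar>"
    using pq by fastforce
  then show ?thesis
  proof cases
    case 1
    then show ?thesis
      using exists_cosine_unbalanced[of p q r s] pq by (simp add: A_def C_def)
  next
    case 2
    then show ?thesis
      using exists_cosine_unbalanced[of r s p q] pq by (simp add: A_def C_def ac_simps)
  next
    case 3
    define t where "t = (C - A) / (4 * (p * q))"
    have t: "\<bar>t\<bar> \<le> 1"
      using 3 pq(2) by (simp add: t_def abs_mult)
    have "4 * (p * q * t) = C - A"
      using pq(2) by (simp add: t_def)
    moreover have "r * s * t = - (p * q * t)"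
      using pq(1) by simp
    ultimately have balanced: "A + 2 * p * q * t = (A + C) / 2" "C + 2 * r * s * t = (A + C) / 2"
      by (simp_all add: mult.assoc)
    have "(sqrt (A + 2 * p * q * t) + sqrt (C + 2 * r * s * t))\<^sup>2 = 2 * (A + C)"
      unfolding balanced by (simp add: A_def C_def power2_eq_square algebra_simps)
    moreover have "(\<bar>p\<bar> + \<bar>q\<bar> + \<bar>r\<bar> + \<bar>s\<bar>) * sqrt (A + C) \<le> 2 * (A + C)"
    proof -
      \<comment> \<open>Cauchy-Schwarz for four terms, by bounding all six cross terms.\<close>
      have "(\<bar>p\<bar> + \<bar>q\<bar> + \<bar>r\<bar> + \<bar>s\<bar>)\<^sup>2 \<le> 4 * (A + C)"
        using sum_squares_bound[of "\<bar>p\<bar>" "\<bar>q\<bar>"] sum_squares_bound[of "\<bar>p\<bar>" "\<bar>r\<bar>"]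
          sum_squares_bound[of "\<bar>p\<bar>" "\<bar>s\<bar>"] sum_squares_bound[of "\<bar>q\<bar>" "\<bar>r\<bar>"]
          sum_squares_bound[of "\<bar>q\<bar>" "\<bar>s\<bar>"] sum_squares_bound[of "\<bar>r\<bar>" "\<bar>s\<bar>"]
        by (simp add: A_def C_def power2_eq_square algebra_simps)
      then have "\<bar>p\<bar> + \<bar>q\<bar> + \<bar>r\<bar> + \<bar>s\<bar> \<le> 2 * sqrt (A + C)"
        by - (rule power2_le_imp_le, auto simp: A_def C_def power_mult_distrib)
      then have "(\<bar>p\<bar> + \<bar>q\<bar> + \<bar>r\<bar> + \<bar>s\<bar>) * sqrt (A + C) \<le> 2 * sqrt (A + C) * sqrt (A + C)"
        by (intro mult_right_mono) (auto simp: A_def C_def)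
      then show ?thesis
        by (simp add: A_def C_def mult.assoc)
    qed
    ultimately have "(\<bar>p\<bar> + \<bar>q\<bar> + \<bar>r\<bar> + \<bar>s\<bar>) * sqrt (A + C)
        \<le> (sqrt (A + 2 * p * q * t) + sqrt (C + 2 * r * s * t))\<^sup>2"
      by simp
    with t show ?thesis
      unfolding A_def C_def by (intro exI[of _ t]) (simp add: add.assoc)
  qed
qed

lemma exists_cosine_same_sign:
  fixes p q r s :: real
  assumes "p * q * (r * s) \<ge> 0"
  shows "\<exists>t. \<bar>t\<bar> \<le> 1 \<and> (\<bar>p\<bar> + \<bar>q\<bar> + \<bar>r\<bar> + \<bar>s\<bar>) * sqrt (p\<^sup>2 + q\<^sup>2 + r\<^sup>2 + s\<^sup>2)
     \<le> (sqrt (p\<^sup>2 + q\<^sup>2 + 2 * p * q * t) + sqrt (r\<^sup>2 + s\<^sup>2 + 2 * r * s * t))\<^sup>2"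
proof -
  \<comment> \<open>A zero product tolerates either sign of \<open>t\<close>. If one product is
    negative, the hypothesis makes the other nonpositive, so -1 serves both.\<close>
  define t :: real where "t = (if p * q \<ge> 0 \<and> r * s \<ge> 0 then 1 else - 1)"
  define N where "N = \<bar>p\<bar> + \<bar>q\<bar> + \<bar>r\<bar> + \<bar>s\<bar>"
  have t: "p * q * t = \<bar>p * q\<bar>" "r * s * t = \<bar>r * s\<bar>"
    using assms by (auto simp: t_def zero_le_mult_iff)
  have root: "sqrt (x\<^sup>2 + y\<^sup>2 + 2 * x * y * t) = \<bar>x\<bar> + \<bar>y\<bar>" if "x * y * t = \<bar>x * y\<bar>" for x y
    using that by (intro real_sqrt_unique) (auto simp: power2_sum abs_mult mult.assoc)
  have "sqrt (p\<^sup>2 + q\<^sup>2 + r\<^sup>2 + s\<^sup>2) \<le> N"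
    by (intro real_le_lsqrt) (auto simp: N_def power2_sum algebra_simps)
  then have "N * sqrt (p\<^sup>2 + q\<^sup>2 + r\<^sup>2 + s\<^sup>2) \<le> N\<^sup>2"
    unfolding power2_eq_square by (intro mult_left_mono) (auto simp: N_def power2_eq_square)
  moreover have "\<bar>t\<bar> \<le> 1"
    by (simp add: t_def)
  moreover have "\<bar>p\<bar> + \<bar>q\<bar> + (\<bar>r\<bar> + \<bar>s\<bar>) = N"
    by (simp add: N_def)
  ultimately show ?thesis
    unfolding N_def[symmetric] by (intro exI[of _ t]) (simp add: root[OF t(1)] root[OF t(2)])
qed

section \<open>Reduction of the sign cases and conclusion\<close>

theorem theorem5p1:
  fixes T :: "(nat \<Rightarrow>\<^sub>C complex) \<Rightarrow> (nat \<Rightarrow>\<^sub>C complex) \<Rightarrow> complex"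
    and a :: "nat \<Rightarrow> nat \<Rightarrow> real"
  assumes T: "\<And>z w. z \<in> c0 \<Longrightarrow> w \<in> c0 \<Longrightarrow>
      T z w = (\<Sum>i<2. \<Sum>j<2. complex_of_real (a i j) * apply_bcontfun z i * apply_bcontfun w j)"
    and cases:
      "(a 0 0 * a 1 0 = 0 \<or> a 0 1 * a 1 1 = 0)
       \<or> (a 0 0 * a 1 0 > 0 \<and> a 0 1 * a 1 1 > 0)
       \<or> (a 0 0 * a 1 0 < 0 \<and> a 0 1 * a 1 1 < 0)
       \<or> (a 0 0 * a 1 0 > 0 \<and> a 0 1 * a 1 1 < 0 \<and> a 0 0 * a 1 0 + a 0 1 * a 1 1 = 0)
       \<or> (a 0 0 * a 1 0 < 0 \<and> a 0 1 * a 1 1 > 0 \<and> a 0 0 * a 1 0 + a 0 1 * a 1 1 = 0)"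
  shows "(\<Sum>i<2. \<Sum>j<2. cmod (T (c0_unit i) (c0_unit j)) powr (4/3)) powr (3/4) \<le> c0_form_norm T"
proof -
  define p q r s where "p = a 0 0" and "q = a 1 0" and "r = a 0 1" and "s = a 1 1"
  note pqrs = p_def[symmetric] q_def[symmetric] r_def[symmetric] s_def[symmetric]
  define I where "I = {..<2::nat} \<times> {..<2::nat}"
  have I_eq: "I = {(0, 0), (1, 0), (0, 1), (1, 1)}"
    by (auto simp: I_def less_2_cases_iff)
  define f where "f = (\<lambda>(i, j). \<bar>a i j\<bar>)"
  \<comment> \<open>The first three cases give the left alternative, the two balanced ones the
    right.\<close>
  have "p * q * (r * s) \<ge> 0 \<or> (p * q = - (r * s) \<and> p * q \<noteq> 0)"
    using cases unfolding pqrs zero_le_mult_iff[of "p * q"] by linarith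
  then obtain t where t: "\<bar>t\<bar> \<le> 1"
    and le: "(\<bar>p\<bar> + \<bar>q\<bar> + \<bar>r\<bar> + \<bar>s\<bar>) * sqrt (p\<^sup>2 + q\<^sup>2 + r\<^sup>2 + s\<^sup>2)
      \<le> (sqrt (p\<^sup>2 + q\<^sup>2 + 2 * p * q * t) + sqrt (r\<^sup>2 + s\<^sup>2 + 2 * r * s * t))\<^sup>2" (is "_ \<le> ?N\<^sup>2")
    using exists_cosine_same_sign[of p q r s] exists_cosine_opposite[of p q r s] by blast
  \<comment> \<open>\<open>sqrt\<close> takes negative values on negative arguments, so the
    radicands must be nonnegative before the square in \<open>le\<close> can be undone.\<close>
  have "0 \<le> x\<^sup>2 + y\<^sup>2 + 2 * x * y * t" for x y :: real
  proof -
    have "\<bar>2 * x * y * t\<bar> \<le> 2 * \<bar>x\<bar> * \<bar>y\<bar>"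
      using t by (simp add: abs_mult mult_left_le)
    then show ?thesis
      using sum_squares_bound[of "\<bar>x\<bar>" "\<bar>y\<bar>"] by simp
  qed
  then have N: "0 \<le> ?N" by simp
  have coeff: "cmod (T (c0_unit i) (c0_unit j)) = \<bar>a i j\<bar>" if "i < 2" "j < 2" for i j
    using that unfolding T[OF c0_unit_in_c0 c0_unit_in_c0]
    by (auto simp: c0_unit_apply numeral_2_eq_2 less_Suc_eq)
  have "(\<Sum>i<2. \<Sum>j<2. cmod (T (c0_unit i) (c0_unit j)) powr (4/3)) = (\<Sum>x\<in>I. f x powr (4/3))"
    by (simp add: I_def f_def coeff sum.cartesian_product case_prod_unfold)
  also have "\<dots> powr (3/4) \<le> sqrt (sum f I * L2_set f I)"
    by (intro sum_powr_four_thirds_le) (auto simp: I_def f_def)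
  also have "sum f I = \<bar>p\<bar> + \<bar>q\<bar> + \<bar>r\<bar> + \<bar>s\<bar>"
    by (simp add: I_eq f_def pqrs del: One_nat_def)
  also have "L2_set f I = sqrt (p\<^sup>2 + q\<^sup>2 + r\<^sup>2 + s\<^sup>2)"
    by (simp add: L2_set_def I_eq f_def pqrs add.assoc del: One_nat_def)
  also have "sqrt ((\<bar>p\<bar> + \<bar>q\<bar> + \<bar>r\<bar> + \<bar>s\<bar>) * sqrt (p\<^sup>2 + q\<^sup>2 + r\<^sup>2 + s\<^sup>2)) \<le> ?N"
    using le N by (intro real_le_lsqrt)
  also have "?N \<le> c0_form_norm T"
    using c0_form_norm_ge[OF T t] unfolding pqrs .
  finally show ?thesis .
qed

end
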